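(* Let $\{m_{ij}\}_{1\le i<j\le n}$ be a collection of positive integers. Then the specialization $$q_{ij}\longmapsto[m_{ij}]_y:=\frac{y^{m_{ij}}-1}{y-1}$$ of the universal Tutte polynomial $T_n(\{q_{ij}\},x,y)$ is equal to the Tutte polynomial of the complete graph $K_n$ in which each edge $(i,j)$ is taken with multiplicity $m_{ij}$.
   Context: The universal Tutte polynomial $T_n(\{q_{ij}\},x,y)\in\mathbb{Z}[\{q_{ij}\}_{1\le i<j\le n},x,y]$ is defined by $$(x-1)\,T_n(\{q_{ij}\},x,y)=\mathrm{Coeff}_{[t_1\cdots t_n]}\left[\Bigl(\sum_{\ell_1,\dots,\ell_n\in\{0,1\}}\ \prod_{1\le i<j\le n}(q_{ij}(y-1)+1)^{\ell_i\ell_j}\,(y-1)^{-\sum_j\ell_j}\,t_1^{\ell_1}\cdots t_n^{\ell_n}\Bigr)^{(x-1)(y-1)}\right],$$ where $\mathrm{Coeff}_{[t_1\cdots t_n]}$ denotes the coefficient of the monomial $t_1t_2\cdots t_n$ and the power is that of a formal power series with constant term $1$. The Tutte polynomial of a graph $\Gamma=(V,E)$ is $\sum_{A\subset E}(x-1)^{\kappa(A)-\kappa(E)}(y-1)^{\kappa(A)+|A|-|V|}$, with $\kappa(A)$ the number of connected components of $(V,A)$. *)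

theory Defs
  imports
    Complex_Main
    "HOL-Library.FuncSet"
    "HOL-Library.Nat_Bijection"
    "HOL-Library.Poly_Mapping"
    "HOL-Computational_Algebra.Fraction_Field"
begin

section \<open>Multivariate polynomials\<close>

text \<open>
  A polynomial with variables in \<open>'v\<close> and coefficients in \<open>'a\<close> is a finitely supported map from
  monomials (finitely supported exponent vectors) to coefficients; the ring structure is the
  convolution product of \<open>Poly_Mapping\<close>.
\<close>

type_synonym ('v, 'a) mpolynomial = "('v \<Rightarrow>\<^sub>0 nat) \<Rightarrow>\<^sub>0 'a"

definition mvar :: "'v \<Rightarrow> ('v, 'a::comm_ring_1) mpolynomial"
  where "mvar v = Poly_Mapping.single (Poly_Mapping.single v 1) 1"

definition mconst :: "'a \<Rightarrow> ('v, 'a::comm_ring_1) mpolynomial"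
  where "mconst c = Poly_Mapping.single 0 c"

definition mvars :: "('v, 'a::comm_ring_1) mpolynomial \<Rightarrow> 'v set"
  where "mvars p = (\<Union>mon \<in> Poly_Mapping.keys p. Poly_Mapping.keys mon)"

definition specialize :: "('v \<Rightarrow> 'b::comm_ring_1) \<Rightarrow> ('v, int) mpolynomial \<Rightarrow> 'b"
  where "specialize f p =
    (\<Sum>mon \<in> Poly_Mapping.keys p. of_int (Poly_Mapping.lookup p mon) *
       (\<Prod>v \<in> Poly_Mapping.keys mon. f v ^ Poly_Mapping.lookup mon v))"

definition mdegree :: "('v \<Rightarrow>\<^sub>0 nat) \<Rightarrow> nat"
  where "mdegree mon = (\<Sum>v \<in> Poly_Mapping.keys mon. Poly_Mapping.lookup mon v)"

text \<open>
  For a polynomial \<open>F\<close> with constant term \<open>1\<close>, \<open>coeff_powr F a mon\<close> is the coefficient of \<open>mon\<close> in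
  the formal power series \<open>F\<^sup>a = (\<Sum>k. (a choose k) (F - 1)\<^sup>k)\<close>. As \<open>F - 1\<close> has no constant term,
  \<open>(F - 1)\<^sup>k\<close> only involves monomials of degree at least \<open>k\<close>, so truncating the sum at the degree of
  \<open>mon\<close> loses nothing.
\<close>

definition coeff_powr ::
    "('v, 'a::field_char_0) mpolynomial \<Rightarrow> 'a \<Rightarrow> ('v \<Rightarrow>\<^sub>0 nat) \<Rightarrow> 'a"
  where "coeff_powr F a mon =
    (\<Sum>k\<le>mdegree mon. (a gchoose k) * Poly_Mapping.lookup ((F - 1) ^ k) mon)"


section \<open>The ring $\mathbb{Z}[\{q_{ij}\},x,y]$ and its field of fractions\<close>

datatype tutte_var = QVar nat nat | XVar | YVar

text \<open>
  The linear order on variables has no mathematical significance; \<open>Poly_Mapping\<close> uses it to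
  establish that the polynomial ring is an integral domain.
\<close>

fun tutte_var_code :: "tutte_var \<Rightarrow> nat" where
  "tutte_var_code XVar = 0"
| "tutte_var_code YVar = 1"
| "tutte_var_code (QVar i j) = prod_encode (i, j) + 2"

lemma tutte_var_code_inject: "tutte_var_code v = tutte_var_code w \<Longrightarrow> v = w"
  by (cases v; cases w) auto

instantiation tutte_var :: linorder
begin

definition "v \<le> w \<longleftrightarrow> tutte_var_code v \<le> tutte_var_code w"

definition "v < w \<longleftrightarrow> tutte_var_code v < tutte_var_code w"

instance
  by standard (auto simp: less_eq_tutte_var_def less_tutte_var_def intro: tutte_var_code_inject)

end

instance fract :: ("{idom, ring_char_0}") field_char_0
  by standard (auto simp: inj_def of_nat_fract eq_fract)

type_synonym tutte_ring = "(tutte_var, int) mpolynomial"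

type_synonym tutte_field = "tutte_ring fract"

abbreviation to_field :: "tutte_ring \<Rightarrow> tutte_field"
  where "to_field p \<equiv> Fract p 1"

abbreviation x_rat :: tutte_field where "x_rat \<equiv> to_field (mvar XVar)"

abbreviation y_rat :: tutte_field where "y_rat \<equiv> to_field (mvar YVar)"

abbreviation q_rat :: "nat \<Rightarrow> nat \<Rightarrow> tutte_field"
  where "q_rat i j \<equiv> to_field (mvar (QVar i j))"

definition tutte_vars :: "nat \<Rightarrow> tutte_var set"
  where "tutte_vars n = {QVar i j | i j. 1 \<le> i \<and> i < j \<and> j \<le> n} \<union> {XVar, YVar}"


section \<open>The universal Tutte polynomial\<close>

text \<open>The variable \<open>t\<^sub>i\<close> is \<open>mvar i\<close>; the exponent vector \<open>\<ell>\<close> is a function \<open>{1..n} \<rightarrow> {0,1}\<close>.\<close>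

definition universal_series :: "nat \<Rightarrow> (nat, tutte_field) mpolynomial"
  where "universal_series n =
    (\<Sum>l \<in> {1..n} \<rightarrow>\<^sub>E {0, 1::nat}.
       mconst ((\<Prod>(i, j) \<in> {(i, j). 1 \<le> i \<and> i < j \<and> j \<le> n}.
                  (q_rat i j * (y_rat - 1) + 1) ^ (l i * l j))
               * (y_rat - 1) powi (- int (\<Sum>j = 1..n. l j)))
       * (\<Prod>j = 1..n. mvar j ^ l j))"

definition is_universal_tutte :: "nat \<Rightarrow> tutte_ring \<Rightarrow> bool"
  where "is_universal_tutte n T \<longleftrightarrow>
    mvars T \<subseteq> tutte_vars n \<and>
    (x_rat - 1) * to_field T =
      coeff_powr (universal_series n) ((x_rat - 1) * (y_rat - 1))
        (\<Sum>j = 1..n. Poly_Mapping.single j 1)"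

text \<open>
  The defining equation determines the polynomial, since \<open>x - 1\<close> is not a zero divisor; it has a
  solution for every \<open>n \<ge> 1\<close>.
\<close>

definition universal_tutte :: "nat \<Rightarrow> tutte_ring"
  where "universal_tutte n = (THE T. is_universal_tutte n T)"


section \<open>The Tutte polynomial of a multigraph\<close>

text \<open>Edges are abstract, so that parallel edges are distinct; \<open>ends e\<close> is the set of endpoints.\<close>

record ('v, 'e) multigraph =
  verts :: "'v set"
  edges :: "'e set"
  ends :: "'e \<Rightarrow> 'v set"

definition adjacent_via :: "('v, 'e) multigraph \<Rightarrow> 'e set \<Rightarrow> ('v \<times> 'v) set"
  where "adjacent_via G A = {(u, v). \<exists>e \<in> A. ends G e = {u, v}}"

text \<open>The number of connected components of the spanning subgraph with edge set \<open>A\<close>.\<close>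

definition num_components :: "('v, 'e) multigraph \<Rightarrow> 'e set \<Rightarrow> nat"
  where "num_components G A =
    card (verts G // {(u, v) \<in> verts G \<times> verts G. (u, v) \<in> (adjacent_via G A)\<^sup>*})"

text \<open>
  The truncated subtractions in the exponents are exact: a finite graph with edge set \<open>A \<subseteq> E\<close> has at
  least as many components as with edge set \<open>E\<close>, and at least \<open>|V| - |A|\<close> of them.
\<close>

definition tutte_polynomial :: "('v, 'e) multigraph \<Rightarrow> tutte_ring"
  where "tutte_polynomial G =
    (\<Sum>A \<in> Pow (edges G).
       (mvar XVar - 1) ^ (num_components G A - num_components G (edges G)) *
       (mvar YVar - 1) ^ (num_components G A + card A - card (verts G)))"

text \<open>\<open>(i, j, k)\<close> is the \<open>k\<close>-th of the \<open>m i j\<close> parallel edges joining \<open>i < j\<close>.\<close>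

definition complete_multigraph ::
    "nat \<Rightarrow> (nat \<Rightarrow> nat \<Rightarrow> nat) \<Rightarrow> (nat, nat \<times> nat \<times> nat) multigraph"
  where "complete_multigraph n m =
    \<lparr>verts = {1..n},
     edges = {(i, j, k). 1 \<le> i \<and> i < j \<and> j \<le> n \<and> k < m i j},
     ends = (\<lambda>(i, j, k). {i, j})\<rparr>"

definition y_bracket :: "nat \<Rightarrow> tutte_field"
  where "y_bracket m = (y_rat ^ m - 1) / (y_rat - 1)"

fun bracket_substitution :: "(nat \<Rightarrow> nat \<Rightarrow> nat) \<Rightarrow> tutte_var \<Rightarrow> tutte_field" where
  "bracket_substitution m (QVar i j) = y_bracket (m i j)"
| "bracket_substitution m XVar = x_rat"
| "bracket_substitution m YVar = y_rat"

end

theory Submission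
  imports Defs "HOL-Computational_Algebra.Polynomial"
begin

text \<open>
  Both sides are sums over sets of edges, and the theorem compares them term by term. Write
  \<open>\<kappa>(A)\<close> for the number of components of the graph on \<open>{1..n}\<close> with edge set \<open>A\<close>.

  The universal Tutte polynomial has the subset expansion
  \[ T_n = \sum_{A \subseteq E(K_n)} \Bigl(\prod_{(i,j) \in A} q_{ij}\Bigr)
       (x-1)^{\kappa(A)-1} (y-1)^{\kappa(A)+|A|-n} \]
  (\<open>universal_tutte_eq_subset_expansion\<close>). To see this, let \<open>F\<close> be the universal series and first
  replace its exponent by a natural number \<open>N\<close>. A contribution to the coefficient of
  \<open>t\<^sub>1 \<cdots> t\<^sub>n\<close> in \<open>F\<^sup>N\<close> picks for each of the \<open>N\<close> factors a set of indices so that these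
  sets partition \<open>{1..n}\<close>, which is the same as a map \<open>f : {1..n} \<rightarrow> {..<N}\<close>
  (\<open>lookup_multilinear_power\<close>). So the coefficient is \<open>(y-1)\<^sup>-\<^sup>n\<close> times the partition function of
  an \<open>N\<close>-state Potts model, in which an edge \<open>(i, j)\<close> has weight \<open>1 + q\<^sub>i\<^sub>j (y-1)\<close> if
  \<open>f i = f j\<close> and weight \<open>1\<close> otherwise. Expanding the product over the edges, a set \<open>A\<close> of edges
  is accompanied by the number of maps that are constant on its components, which is
  \<open>N\<^bsup>\<kappa>(A)\<^esup>\<close> (\<open>potts_partition_function\<close>). Since the coefficient in \<open>F\<^sup>a\<close> is a polynomial in
  \<open>a\<close>, and so is the result just obtained, equality for all natural numbers gives equality for
  \<open>a = (x-1)(y-1)\<close> (\<open>coeff_powr_eqI\<close>). The powers of \<open>y-1\<close> that remain are nonnegative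
  because \<open>n \<le> \<kappa>(A) + |A|\<close>.

  On the graph side, an edge set \<open>B\<close> of the multigraph has as many components as the set \<open>A\<close> of
  pairs that it joins. Summing \<open>(y-1)\<^bsup>|B|\<^esup>\<close> over all \<open>B\<close> with the same \<open>A\<close> means choosing a
  nonempty set of parallel edges for each pair in \<open>A\<close>, and gives the product of the factors
  \<open>y\<^bsup>m i j\<^esup> - 1\<close>, that is, of \<open>[m i j]\<^sub>y (y-1)\<close> (\<open>sum_Pow_by_image\<close>). This is the specialized
  subset expansion.
\<close>

section \<open>Components of graphs and constant colourings\<close>

text \<open>
  A simple graph is encoded by its vertex set \<open>V\<close> and a set \<open>A \<subseteq> V \<times> V\<close> in which the
  orientation of a pair is irrelevant. \<open>connectivity V A\<close> is the relation on \<open>V\<close> of being joined by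
  a path, and \<open>components V A\<close> is the number of its classes.
\<close>

definition connectivity :: "'a set \<Rightarrow> ('a \<times> 'a) set \<Rightarrow> ('a \<times> 'a) set"
  where "connectivity V A = {(u, v) \<in> V \<times> V. (u, v) \<in> (A \<union> A\<inverse>)\<^sup>*}"

definition components :: "'a set \<Rightarrow> ('a \<times> 'a) set \<Rightarrow> nat"
  where "components V A = card (V // connectivity V A)"

lemma sym_closure_rtrancl: "(u, v) \<in> (A \<union> A\<inverse>)\<^sup>* \<Longrightarrow> (v, u) \<in> (A \<union> A\<inverse>)\<^sup>*"
  by (metis symD sym_Un_converse sym_rtrancl)

lemma equiv_connectivity: "equiv V (connectivity V A)"
  unfolding connectivity_def
  by (rule equivI) (auto simp: refl_on_def intro!: symI transI intro: sym_closure_rtrancl rtrancl_trans)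

lemma constant_on_connectivity:
  assumes "\<And>i j. (i, j) \<in> A \<Longrightarrow> f i = f j" "(u, v) \<in> connectivity V A"
  shows "f u = f v"
proof -
  have "(u, v) \<in> (A \<union> A\<inverse>)\<^sup>*"
    using assms(2) by (simp add: connectivity_def)
  then show ?thesis
    by induction (use assms(1) in force)+
qed

text \<open>
  Such functions are exactly the functions on the set of components.
\<close>

lemma card_constant_functions:
  assumes "finite V" "A \<subseteq> V \<times> V"
  shows "card {f \<in> V \<rightarrow>\<^sub>E {..<N::nat}. \<forall>(i, j)\<in>A. f i = f j} = N ^ components V A"
proof -
  define R where "R = connectivity V A"
  have R: "equiv V R"
    by (simp add: R_def equiv_connectivity)
  have AR: "A \<subseteq> R"
    using assms(2) by (auto simp: R_def connectivity_def)
  have "finite (V // R)"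
    using assms(1) R by (meson equiv_type finite_quotient)
  have in_class: "R `` {i} \<in> V // R" if "i \<in> V" for i
    using that by (rule quotientI)
  define \<Phi> where "\<Phi> = (\<lambda>h::'a set \<Rightarrow> nat. restrict (\<lambda>i. h (R `` {i})) V)"
  have "bij_betw \<Phi> (V // R \<rightarrow>\<^sub>E {..<N}) {f \<in> V \<rightarrow>\<^sub>E {..<N}. \<forall>(i, j)\<in>A. f i = f j}"
    unfolding bij_betw_def
  proof (intro conjI inj_onI equalityI subsetI)
    fix h h' assume h: "h \<in> V // R \<rightarrow>\<^sub>E {..<N}" and h': "h' \<in> V // R \<rightarrow>\<^sub>E {..<N}" and eq: "\<Phi> h = \<Phi> h'"
    show "h = h'"
    proof (rule PiE_ext[OF h h'])
      fix X assume "X \<in> V // R"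
      then obtain i where "i \<in> V" "X = R `` {i}"
        by (rule quotientE)
      with fun_cong[OF eq, of i] show "h X = h' X"
        by (simp add: \<Phi>_def)
    qed
  next
    fix f assume "f \<in> \<Phi> ` (V // R \<rightarrow>\<^sub>E {..<N})"
    then obtain h where h: "h \<in> V // R \<rightarrow>\<^sub>E {..<N}" and f: "f = \<Phi> h"
      by blast
    have "f i = f j" if "(i, j) \<in> A" for i j
    proof -
      have "i \<in> V" "j \<in> V"
        using that assms(2) by auto
      moreover have "R `` {i} = R `` {j}"
        using that AR equiv_class_eq[OF R] by blast
      ultimately show ?thesis
        by (simp add: f \<Phi>_def)
    qed
    moreover have "h (R `` {i}) < N" if "i \<in> V" for i
      using PiE_mem[OF h in_class[OF that]] by simp
    then have "f \<in> V \<rightarrow>\<^sub>E {..<N}"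
      by (simp add: f \<Phi>_def)
    ultimately show "f \<in> {f \<in> V \<rightarrow>\<^sub>E {..<N}. \<forall>(i, j)\<in>A. f i = f j}"
      by blast
  next
    fix f assume f: "f \<in> {f \<in> V \<rightarrow>\<^sub>E {..<N}. \<forall>(i, j)\<in>A. f i = f j}"
    have const: "f i = f j" if "(i, j) \<in> R" for i j
      using constant_on_connectivity[of A f i j V] f that by (auto simp: R_def)
    define h where "h = restrict (\<lambda>X. the_elem (f ` X)) (V // R)"
    have h_class: "h (R `` {i}) = f i" if "i \<in> V" for i
    proof -
      have "f ` (R `` {i}) = {f i}"
      proof
        show "f ` (R `` {i}) \<subseteq> {f i}"
          using const by force
        show "{f i} \<subseteq> f ` (R `` {i})"
          using equiv_class_self[OF R that] by blast
      qed
      then show ?thesis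
        using in_class[OF that] by (simp add: h_def)
    qed
    have f_lt: "f i < N" if "i \<in> V" for i
      using f that by auto
    have "h X < N" if "X \<in> V // R" for X
    proof -
      obtain i where "i \<in> V" "X = R `` {i}"
        using \<open>X \<in> V // R\<close> by (rule quotientE)
      then show ?thesis
        using h_class f_lt by simp
    qed
    then have "h \<in> V // R \<rightarrow>\<^sub>E {..<N}"
      by (auto simp: h_def)
    moreover have "\<Phi> h = f"
    proof
      fix i
      have "f i = undefined" if "i \<notin> V"
        using f that by (auto intro: PiE_arb)
      then show "\<Phi> h i = f i"
        using h_class by (auto simp: \<Phi>_def restrict_def)
    qed
    ultimately show "f \<in> \<Phi> ` (V // R \<rightarrow>\<^sub>E {..<N})"
      by blast
  qed
  then have "card {f \<in> V \<rightarrow>\<^sub>E {..<N}. \<forall>(i, j)\<in>A. f i = f j} = card (V // R \<rightarrow>\<^sub>E {..<N})"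
    by (simp add: bij_betw_same_card)
  with \<open>finite (V // R)\<close> show ?thesis
    by (simp add: card_funcsetE components_def R_def)
qed

text \<open>
  Adding an edge \<open>(a, b)\<close> merges at most two components: away from the component of \<open>a\<close>, the map
  from old to new components is injective.
\<close>

lemma components_insert:
  assumes "finite V" "a \<in> V" "b \<in> V"
  shows "components V A \<le> components V (insert (a, b) A) + 1"
proof -
  define R where "R = connectivity V A"
  define R' where "R' = connectivity V (insert (a, b) A)"
  have R: "equiv V R" and R': "equiv V R'"
    by (simp_all add: R_def R'_def equiv_connectivity)
  have fin: "finite (V // R)" "finite (V // R')"
    using assms(1) R R' by (meson equiv_type finite_quotient)+
  have sub: "R \<subseteq> R'"
    unfolding R_def R'_def connectivity_def
    using rtrancl_mono[of "A \<union> A\<inverse>" "insert (a, b) A \<union> (insert (a, b) A)\<inverse>"] by blast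
  have image: "R' `` (R `` {x}) = R' `` {x}" if "x \<in> V" for x
  proof
    show "R' `` (R `` {x}) \<subseteq> R' `` {x}"
      using sub R' unfolding equiv_def by (auto dest: transD)
    show "R' `` {x} \<subseteq> R' `` (R `` {x})"
      using equiv_class_self[OF R that] by blast
  qed
  have join: "(x, y) \<in> R" if "(x, y) \<in> R'" "(x, a) \<notin> R" "(y, a) \<notin> R" for x y
  proof -
    have *: "insert (a, b) A \<union> (insert (a, b) A)\<inverse> = insert (a, b) (insert (b, a) (A \<union> A\<inverse>))"
      by auto
    show ?thesis
      using that assms(2,3) unfolding R_def R'_def connectivity_def * rtrancl_insert
      by (auto dest: sym_closure_rtrancl intro: rtrancl_trans)
  qed
  have "inj_on (\<lambda>X. R' `` X) (V // R - {R `` {a}})"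
  proof (rule inj_onI)
    fix X Y assume X: "X \<in> V // R - {R `` {a}}" and Y: "Y \<in> V // R - {R `` {a}}"
      and eq: "R' `` X = R' `` Y"
    obtain x where x: "x \<in> V" "X = R `` {x}"
      using X by (auto elim: quotientE)
    obtain y where y: "y \<in> V" "Y = R `` {y}"
      using Y by (auto elim: quotientE)
    have "(x, a) \<notin> R" "(y, a) \<notin> R"
      using X Y x y equiv_class_eq[OF R] by auto
    moreover have "(x, y) \<in> R'"
      using eq x y image eq_equiv_class[OF _ R'] by simp
    ultimately show "X = Y"
      using join equiv_class_eq[OF R] x y by blast
  qed
  moreover have "(\<lambda>X. R' `` X) ` (V // R - {R `` {a}}) \<subseteq> V // R'"
    using image by (auto elim!: quotientE intro: quotientI)
  ultimately have "card (V // R - {R `` {a}}) \<le> card (V // R')"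
    using fin by (meson card_inj_on_le)
  then show ?thesis
    using fin by (simp add: components_def R_def R'_def card_Diff_singleton_if split: if_splits)
qed

lemma components_empty:
  assumes "finite V"
  shows "components V {} = card V"
proof -
  have "connectivity V {} = Id_on V"
    by (auto simp: connectivity_def)
  moreover have "V // Id_on V = (\<lambda>v. {v}) ` V"
    by (auto simp: quotient_def)
  ultimately show ?thesis
    by (simp add: components_def card_image)
qed

lemma card_le_components_plus_card:
  assumes "finite V" "finite A" "A \<subseteq> V \<times> V"
  shows "card V \<le> components V A + card A"
  using assms(2,3)
proof induction
  case empty
  then show ?case by (simp add: components_empty assms(1))
next
  case (insert e A)
  obtain a b where e: "e = (a, b)" by fastforce
  show ?case
    using insert components_insert[OF assms(1), of a b A] by (simp add: e)
qed

lemma components_pos: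
  assumes "finite V" "V \<noteq> {}"
  shows "components V A \<ge> 1"
proof -
  have "finite (V // connectivity V A)"
    using assms(1) equiv_connectivity by (meson equiv_type finite_quotient)
  moreover have "V // connectivity V A \<noteq> {}"
    using assms(2) by simp
  ultimately show ?thesis
    by (simp add: components_def Suc_le_eq card_gt_0_iff)
qed

text \<open>
  The Fortuin--Kasteleyn expansion: multiplying out the product turns the sum over colourings into
  a sum over edge sets \<open>A\<close>, and the colourings compatible with \<open>A\<close> are those that are constant
  along its edges.
\<close>

lemma potts_partition_function:
  fixes z :: "'a \<times> 'a \<Rightarrow> 'b::comm_semiring_1"
  assumes "finite V" "P \<subseteq> V \<times> V"
  shows "(\<Sum>f\<in>V \<rightarrow>\<^sub>E {..<N::nat}. \<Prod>(i, j)\<in>P. if f i = f j then z (i, j) + 1 else 1)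
    = (\<Sum>A\<in>Pow P. (\<Prod>e\<in>A. z e) * of_nat N ^ components V A)"
proof -
  have fin: "finite P"
    using assms by (meson finite_SigmaI finite_subset)
  have finV: "finite (V \<rightarrow>\<^sub>E {..<N})"
    by (simp add: finite_PiE assms(1))
  have "(\<Prod>(i, j)\<in>P. if f i = f j then z (i, j) + 1 else 1)
      = (\<Sum>A\<in>Pow P. if \<forall>(i, j)\<in>A. f i = f j then \<Prod>e\<in>A. z e else 0)" for f :: "'a \<Rightarrow> nat"
  proof -
    have "(\<Prod>(i, j)\<in>P. if f i = f j then z (i, j) + 1 else 1)
        = (\<Prod>e\<in>P. (if f (fst e) = f (snd e) then z e else 0) + 1)"
      by (rule prod.cong) (auto simp: case_prod_beta)
    also have "\<dots> = (\<Sum>A\<in>Pow P. \<Prod>e\<in>A. if f (fst e) = f (snd e) then z e else 0)"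
      using prod_add[OF fin, of "\<lambda>e. if f (fst e) = f (snd e) then z e else 0" "\<lambda>_. 1"] by simp
    also have "\<dots> = (\<Sum>A\<in>Pow P. if \<forall>(i, j)\<in>A. f i = f j then \<Prod>e\<in>A. z e else 0)"
    proof (rule sum.cong[OF refl])
      fix A assume "A \<in> Pow P"
      then have "finite A"
        using fin finite_subset by auto
      then show "(\<Prod>e\<in>A. if f (fst e) = f (snd e) then z e else 0)
          = (if \<forall>(i, j)\<in>A. f i = f j then \<Prod>e\<in>A. z e else 0)"
      proof (cases "\<forall>(i, j)\<in>A. f i = f j")
        case True
        then show ?thesis
          by (force intro!: prod.cong)
      next
        case False
        then obtain e where "e \<in> A" "f (fst e) \<noteq> f (snd e)"
          by auto
        then have "(\<Prod>e\<in>A. if f (fst e) = f (snd e) then z e else 0) = 0"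
          by (intro prod_zero \<open>finite A\<close> bexI[of _ e]) simp_all
        then show ?thesis
          by (simp only: False if_False)
      qed
    qed
    finally show ?thesis .
  qed
  then have "(\<Sum>f\<in>V \<rightarrow>\<^sub>E {..<N}. \<Prod>(i, j)\<in>P. if f i = f j then z (i, j) + 1 else 1)
      = (\<Sum>A\<in>Pow P. \<Sum>f\<in>V \<rightarrow>\<^sub>E {..<N}. if \<forall>(i, j)\<in>A. f i = f j then \<Prod>e\<in>A. z e else 0)"
    by (simp add: sum.swap[of _ "Pow P"])
  also have "\<dots> = (\<Sum>A\<in>Pow P. (\<Prod>e\<in>A. z e) * of_nat N ^ components V A)"
  proof (rule sum.cong[OF refl])
    fix A assume "A \<in> Pow P"
    then have "A \<subseteq> V \<times> V"
      using assms(2) by blast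
    have "(\<Sum>f\<in>V \<rightarrow>\<^sub>E {..<N}. if \<forall>(i, j)\<in>A. f i = f j then \<Prod>e\<in>A. z e else 0)
        = (\<Sum>f\<in>{f \<in> V \<rightarrow>\<^sub>E {..<N}. \<forall>(i, j)\<in>A. f i = f j}. \<Prod>e\<in>A. z e)"
      by (rule sum.inter_filter[OF finV, symmetric])
    also have "\<dots> = (\<Prod>e\<in>A. z e) * of_nat N ^ components V A"
      using card_constant_functions[OF assms(1) \<open>A \<subseteq> V \<times> V\<close>, of N]
      by (simp add: mult.commute)
    finally show "(\<Sum>f\<in>V \<rightarrow>\<^sub>E {..<N}. if \<forall>(i, j)\<in>A. f i = f j then \<Prod>e\<in>A. z e else 0)
        = (\<Prod>e\<in>A. z e) * of_nat N ^ components V A" .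
  qed
  finally show ?thesis .
qed

section \<open>Powers of polynomials with arbitrary exponent\<close>

lemma mdegree_superset:
  assumes "finite X" "Poly_Mapping.keys mon \<subseteq> X"
  shows "mdegree mon = (\<Sum>v\<in>X. Poly_Mapping.lookup mon v)"
  unfolding mdegree_def
  by (rule sum.mono_neutral_left) (use assms in \<open>auto simp: in_keys_iff\<close>)

lemma mdegree_add: "mdegree (a + b) = mdegree a + mdegree b"
proof -
  let ?X = "Poly_Mapping.keys a \<union> Poly_Mapping.keys b"
  have "mdegree (a + b) = (\<Sum>v\<in>?X. Poly_Mapping.lookup (a + b) v)"
    by (rule mdegree_superset) (simp_all add: keys_add)
  moreover have "mdegree a = (\<Sum>v\<in>?X. Poly_Mapping.lookup a v)"
    by (rule mdegree_superset) auto
  moreover have "mdegree b = (\<Sum>v\<in>?X. Poly_Mapping.lookup b v)"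
    by (rule mdegree_superset) auto
  ultimately show ?thesis
    by (simp add: lookup_add sum.distrib)
qed

lemma mdegree_eq_0_iff: "mdegree mon = 0 \<longleftrightarrow> mon = 0"
proof
  assume "mdegree mon = 0"
  then show "mon = 0"
    by (auto simp: mdegree_def in_keys_iff intro!: poly_mapping_eqI)
qed (simp add: mdegree_def)

text \<open>
  This justifies the truncation in \<^const>\<open>coeff_powr\<close>.
\<close>

lemma mdegree_keys_power:
  fixes p :: "('v, 'a::comm_ring_1) mpolynomial"
  assumes "Poly_Mapping.lookup p 0 = 0" "mon \<in> Poly_Mapping.keys (p ^ k)"
  shows "k \<le> mdegree mon"
  using assms(2)
proof (induction k arbitrary: mon)
  case (Suc k)
  obtain a b where ab: "mon = a + b" "a \<in> Poly_Mapping.keys p" "b \<in> Poly_Mapping.keys (p ^ k)"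
    using Suc.prems keys_mult[of p "p ^ k"] by auto
  then have "a \<noteq> 0"
    using assms(1) by (auto simp: in_keys_iff)
  then have "mdegree a \<ge> 1"
    using mdegree_eq_0_iff[of a] by simp
  with Suc.IH[OF ab(3)] show ?case
    by (simp add: ab mdegree_add)
qed simp

lemma coeff_powr_of_nat:
  fixes F :: "('v, 'a::field_char_0) mpolynomial"
  assumes "Poly_Mapping.lookup F 0 = 1"
  shows "coeff_powr F (of_nat N) mon = Poly_Mapping.lookup (F ^ N) mon"
proof -
  let ?c = "\<lambda>k. of_nat (N choose k) * Poly_Mapping.lookup ((F - 1) ^ k) mon"
  have scale: "Poly_Mapping.lookup (of_nat c * p) m = of_nat c * Poly_Mapping.lookup p m"
    for c :: nat and p :: "('v, 'a) mpolynomial" and m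
    by (induction c) (simp_all add: distrib_right lookup_add)
  have "F ^ N = (\<Sum>k\<le>N. of_nat (N choose k) * (F - 1) ^ k)"
    using binomial_ring[of "F - 1" 1 N] by simp
  then have "Poly_Mapping.lookup (F ^ N) mon = (\<Sum>k\<le>N. ?c k)"
    by (simp add: lookup_sum scale)
  also have "\<dots> = (\<Sum>k\<le>max N (mdegree mon). ?c k)"
    by (rule sum.mono_neutral_left) auto
  also have "\<dots> = (\<Sum>k\<le>mdegree mon. ?c k)"
  proof (rule sum.mono_neutral_right)
    have "Poly_Mapping.lookup (F - 1) 0 = 0"
      using assms by (simp add: lookup_minus)
    then have "Poly_Mapping.lookup ((F - 1) ^ k) mon = 0" if "\<not> k \<le> mdegree mon" for k
      using mdegree_keys_power[of "F - 1" mon k] that by (auto simp: in_keys_iff)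
    then show "\<forall>k\<in>{..max N (mdegree mon)} - {..mdegree mon}. ?c k = 0"
      by simp
  qed auto
  finally show ?thesis
    by (simp add: coeff_powr_def binomial_gbinomial)
qed

lemma gchoose_poly: "\<exists>p::'a::field_char_0 poly. \<forall>a. poly p a = a gchoose k"
proof
  show "\<forall>a. poly (smult (1 / fact k) (\<Prod>i = 0..<k. [:- of_nat i, 1:])) a = (a::'a) gchoose k"
    by (simp add: gbinomial_prod_rev poly_prod)
qed

lemma coeff_powr_poly:
  fixes F :: "('v, 'a::field_char_0) mpolynomial"
  shows "\<exists>p. \<forall>a. poly p a = coeff_powr F a mon"
proof -
  obtain g :: "nat \<Rightarrow> 'a poly" where g: "\<And>k a. poly (g k) a = a gchoose k"
    using gchoose_poly by metis
  show ?thesis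
    by (rule exI[of _ "\<Sum>k\<le>mdegree mon. smult (Poly_Mapping.lookup ((F - 1) ^ k) mon) (g k)"])
       (simp add: poly_sum g coeff_powr_def mult.commute)
qed

text \<open>
  Two polynomials that agree on the natural numbers are equal, so it suffices to know the
  coefficient for natural exponents.
\<close>

lemma coeff_powr_eqI:
  fixes F :: "('v, 'a::field_char_0) mpolynomial"
  assumes "Poly_Mapping.lookup F 0 = 1"
    and "\<And>N. Poly_Mapping.lookup (F ^ N) mon = poly p (of_nat N)"
  shows "coeff_powr F a mon = poly p a"
proof -
  obtain q where q: "\<And>a. poly q a = coeff_powr F a mon"
    using coeff_powr_poly by blast
  have "range of_nat \<subseteq> {a. poly (q - p) a = 0}"
    using assms by (auto simp: q coeff_powr_of_nat)
  then have "infinite {a. poly (q - p) a = 0}"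
    using infinite_super[OF _ infinite_UNIV_char_0[where 'a='a]] infinite_super
      range_inj_infinite[OF inj_of_nat] by blast
  then have "q - p = 0"
    using poly_roots_finite by blast
  then show ?thesis
    using q[of a] by simp
qed

section \<open>Coefficients of squarefree monomials\<close>

text \<open>
  The exponent vector of the squarefree monomial \<open>\<Prod>j\<in>S. t\<^sub>j\<close>, that is, the indicator function of
  \<open>S\<close>. It is \<open>0\<close> when \<open>S\<close> is infinite.
\<close>

definition multilinear :: "'v set \<Rightarrow> 'v \<Rightarrow>\<^sub>0 nat"
  where "multilinear S = (\<Sum>j\<in>S. Poly_Mapping.single j 1)"

lemma lookup_multilinear:
  "finite S \<Longrightarrow> Poly_Mapping.lookup (multilinear S) j = (if j \<in> S then 1 else 0)"
  by (simp add: multilinear_def lookup_sum lookup_single when_def sum.delta)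

lemma multilinear_eq_0_iff: "finite S \<Longrightarrow> multilinear S = 0 \<longleftrightarrow> S = {}"
  by (metis all_not_in_conv lookup_multilinear lookup_zero multilinear_def sum.empty zero_neq_one)

lemma prod_single:
  fixes c :: "'i \<Rightarrow> 'a::comm_ring_1" and mon :: "'i \<Rightarrow> 'v \<Rightarrow>\<^sub>0 nat"
  shows "(\<Prod>i\<in>I. Poly_Mapping.single (mon i) (c i)) = Poly_Mapping.single (\<Sum>i\<in>I. mon i) (\<Prod>i\<in>I. c i)"
  by (induction I rule: infinite_finite_induct) (auto simp: mult_single)

text \<open>
  Multiplying out the \<open>N\<close>-th power, the sets \<open>g 0, \<dots>, g (N - 1)\<close> that are picked contribute to
  the monomial of \<open>V\<close> precisely if every \<open>i \<in> V\<close> lies in exactly one of them; they are then the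
  fibres of the function that maps \<open>i\<close> to this index.
\<close>

lemma lookup_multilinear_power:
  fixes c :: "'v set \<Rightarrow> 'a::comm_ring_1"
  assumes "finite V"
  shows "Poly_Mapping.lookup ((\<Sum>S\<in>Pow V. Poly_Mapping.single (multilinear S) (c S)) ^ N) (multilinear V)
    = (\<Sum>f\<in>V \<rightarrow>\<^sub>E {..<N}. \<Prod>k<N. c {i \<in> V. f i = k})"
proof -
  let ?G = "{..<N} \<rightarrow>\<^sub>E Pow V"
  have finG: "finite ?G"
    using assms by (simp add: finite_PiE)
  have "(\<Sum>S\<in>Pow V. Poly_Mapping.single (multilinear S) (c S)) ^ N
      = (\<Prod>k<N. \<Sum>S\<in>Pow V. Poly_Mapping.single (multilinear S) (c S))"
    by simp
  also have "\<dots> = (\<Sum>g\<in>?G. \<Prod>k<N. Poly_Mapping.single (multilinear (g k)) (c (g k)))"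
    by (rule prod_sum_PiE) (use assms in auto)
  also have "\<dots> = (\<Sum>g\<in>?G. Poly_Mapping.single (\<Sum>k<N. multilinear (g k)) (\<Prod>k<N. c (g k)))"
    by (simp add: prod_single)
  finally have "Poly_Mapping.lookup ((\<Sum>S\<in>Pow V. Poly_Mapping.single (multilinear S) (c S)) ^ N) (multilinear V)
      = (\<Sum>g\<in>?G. if (\<Sum>k<N. multilinear (g k)) = multilinear V then \<Prod>k<N. c (g k) else 0)"
    by (simp add: lookup_sum lookup_single when_def)
  also have "\<dots> = (\<Sum>g\<in>{g \<in> ?G. (\<Sum>k<N. multilinear (g k)) = multilinear V}. \<Prod>k<N. c (g k))"
    by (rule sum.inter_filter[OF finG, symmetric])
  \<comment> \<open>The exponent of \<open>t\<^sub>i\<close> in the product counts the sets \<open>g k\<close> that contain \<open>i\<close>.\<close>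
  also have "{g \<in> ?G. (\<Sum>k<N. multilinear (g k)) = multilinear V}
      = {g \<in> ?G. \<forall>i\<in>V. \<exists>!k. k < N \<and> i \<in> g k}" (is "?L = ?R")
  proof (rule Collect_cong, rule conj_cong[OF refl])
    fix g assume g: "g \<in> ?G"
    have fing: "finite (g k)" if "k < N" for k
      using g that assms by (auto simp: PiE_iff intro: finite_subset)
    have count: "Poly_Mapping.lookup (\<Sum>k<N. multilinear (g k)) i = card {k. k < N \<and> i \<in> g k}" for i
    proof -
      have "Poly_Mapping.lookup (\<Sum>k<N. multilinear (g k)) i = (\<Sum>k<N. if i \<in> g k then 1 else 0)"
        by (auto simp: lookup_sum lookup_multilinear fing intro!: sum.cong)
      also have "\<dots> = card {k \<in> {..<N}. i \<in> g k}"
        by (subst sum.inter_filter[symmetric]) auto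
      finally show ?thesis by simp
    qed
    have "(\<Sum>k<N. multilinear (g k)) = multilinear V
        \<longleftrightarrow> (\<forall>i. card {k. k < N \<and> i \<in> g k} = (if i \<in> V then 1 else 0))"
      by (simp add: poly_mapping_eq_iff fun_eq_iff count lookup_multilinear assms)
    also have "\<dots> \<longleftrightarrow> (\<forall>i\<in>V. card {k. k < N \<and> i \<in> g k} = 1)"
    proof -
      have "{k. k < N \<and> i \<in> g k} = {}" if "i \<notin> V" for i
        using g that by (fastforce simp: PiE_iff)
      then have "card {k. k < N \<and> i \<in> g k} = 0" if "i \<notin> V" for i
        using that by simp
      then show ?thesis
        by metis
    qed
    also have "\<dots> \<longleftrightarrow> (\<forall>i\<in>V. \<exists>!k. k < N \<and> i \<in> g k)"
    proof (rule ball_cong[OF refl])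
      fix i
      show "card {k. k < N \<and> i \<in> g k} = 1 \<longleftrightarrow> (\<exists>!k. k < N \<and> i \<in> g k)"
        unfolding One_nat_def card_1_singleton_iff set_eq_iff mem_Collect_eq singleton_iff by metis
    qed
    finally show "(\<Sum>k<N. multilinear (g k)) = multilinear V \<longleftrightarrow> (\<forall>i\<in>V. \<exists>!k. k < N \<and> i \<in> g k)" .
  qed
  also have "(\<Sum>g\<in>?R. \<Prod>k<N. c (g k)) = (\<Sum>f\<in>V \<rightarrow>\<^sub>E {..<N}. \<Prod>k<N. c {i \<in> V. f i = k})"
  proof (rule sum.reindex_bij_witness[where
        i = "\<lambda>f. \<lambda>k\<in>{..<N}. {i \<in> V. f i = k}" and j = "\<lambda>g. \<lambda>i\<in>V. THE k. k < N \<and> i \<in> g k"])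
    fix g assume g: "g \<in> ?R"
    let ?f = "\<lambda>i\<in>V. THE k. k < N \<and> i \<in> g k"
    have uniq: "\<exists>!k. k < N \<and> i \<in> g k" if "i \<in> V" for i
      using g that by blast
    have the: "?f i < N \<and> i \<in> g (?f i)" if "i \<in> V" for i
      using theI'[OF uniq[OF that]] that by simp
    have fibre: "{i \<in> V. ?f i = k} = g k" if "k < N" for k
      using the uniq that g by (fastforce simp: PiE_iff)
    show "(\<lambda>k\<in>{..<N}. {i \<in> V. ?f i = k}) = g"
      using fibre g by (fastforce simp: PiE_iff extensional_def fun_eq_iff restrict_def)
    show "?f \<in> V \<rightarrow>\<^sub>E {..<N}"
      using the by auto
    show "(\<Prod>k<N. c {i \<in> V. ?f i = k}) = (\<Prod>k<N. c (g k))"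
      using fibre by (intro prod.cong) auto
  next
    fix f assume f: "f \<in> V \<rightarrow>\<^sub>E {..<N}"
    let ?g = "\<lambda>k\<in>{..<N}. {i \<in> V. f i = k}"
    have mem: "k < N \<and> i \<in> ?g k \<longleftrightarrow> k = f i" if "i \<in> V" for i k
      using f that by auto
    show "(\<lambda>i\<in>V. THE k. k < N \<and> i \<in> ?g k) = f"
      using f by (intro ext) (auto simp: mem restrict_def PiE_iff extensional_def simp del: restrict_apply)
    show "?g \<in> ?R"
      using mem by auto
  qed
  finally show ?thesis .
qed

section \<open>Substitution into polynomials\<close>

text \<open>
  The value of the monomial with exponent vector \<open>mon\<close> under the substitution \<open>f\<close>.
\<close>

definition monomial_value :: "('v \<Rightarrow> 'b::comm_ring_1) \<Rightarrow> ('v \<Rightarrow>\<^sub>0 nat) \<Rightarrow> 'b"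
  where "monomial_value f mon = (\<Prod>v\<in>Poly_Mapping.keys mon. f v ^ Poly_Mapping.lookup mon v)"

lemma monomial_value_superset:
  assumes "finite X" "Poly_Mapping.keys mon \<subseteq> X"
  shows "monomial_value f mon = (\<Prod>v\<in>X. f v ^ Poly_Mapping.lookup mon v)"
  unfolding monomial_value_def
  by (rule prod.mono_neutral_left) (use assms in \<open>auto simp: in_keys_iff\<close>)

lemma monomial_value_add: "monomial_value f (a + b) = monomial_value f a * monomial_value f b"
proof -
  let ?X = "Poly_Mapping.keys a \<union> Poly_Mapping.keys b"
  have "monomial_value f (a + b) = (\<Prod>v\<in>?X. f v ^ Poly_Mapping.lookup (a + b) v)"
    by (rule monomial_value_superset) (simp_all add: keys_add)
  moreover have "monomial_value f a = (\<Prod>v\<in>?X. f v ^ Poly_Mapping.lookup a v)"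
    by (rule monomial_value_superset) auto
  moreover have "monomial_value f b = (\<Prod>v\<in>?X. f v ^ Poly_Mapping.lookup b v)"
    by (rule monomial_value_superset) auto
  ultimately show ?thesis
    by (simp add: lookup_add power_add prod.distrib)
qed

lemma specialize_superset:
  assumes "finite X" "Poly_Mapping.keys p \<subseteq> X"
  shows "specialize f p = (\<Sum>mon\<in>X. of_int (Poly_Mapping.lookup p mon) * monomial_value f mon)"
  unfolding specialize_def monomial_value_def
  by (rule sum.mono_neutral_left) (use assms in \<open>auto simp: in_keys_iff\<close>)

lemma specialize_add: "specialize f (p + q) = specialize f p + specialize f q"
proof -
  let ?X = "Poly_Mapping.keys p \<union> Poly_Mapping.keys q"
  let ?s = "\<lambda>r. \<Sum>mon\<in>?X. of_int (Poly_Mapping.lookup r mon) * monomial_value f mon"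
  have "specialize f (p + q) = ?s (p + q)"
    by (rule specialize_superset) (simp_all add: keys_add)
  moreover have "specialize f p = ?s p" "specialize f q = ?s q"
    by (rule specialize_superset; auto)+
  ultimately show ?thesis
    by (simp add: lookup_add sum.distrib algebra_simps)
qed

lemma specialize_zero [simp]: "specialize f 0 = 0"
  by (simp add: specialize_def)

lemma specialize_diff: "specialize f (p - q) = specialize f p - specialize f q"
  using specialize_add[of f "p - q" q] by (simp add: algebra_simps)

lemma specialize_sum: "specialize f (\<Sum>i\<in>I. p i) = (\<Sum>i\<in>I. specialize f (p i))"
  by (induction I rule: infinite_finite_induct) (auto simp: specialize_add)

lemma specialize_single:
  "specialize f (Poly_Mapping.single mon c) = of_int c * monomial_value f mon"
  by (subst specialize_superset[of "{mon}"]) (auto split: if_splits)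

lemma sum_of_monomials:
  "p = (\<Sum>mon\<in>Poly_Mapping.keys p. Poly_Mapping.single mon (Poly_Mapping.lookup p mon))"
  by (rule poly_mapping_eqI) (simp add: lookup_sum lookup_single when_def in_keys_iff sum.delta)

lemma specialize_mult: "specialize f (p * q) = specialize f p * specialize f q"
proof -
  let ?s = "\<lambda>r mon. Poly_Mapping.single mon (Poly_Mapping.lookup r mon)"
  have "p * q = (\<Sum>a\<in>Poly_Mapping.keys p. ?s p a) * (\<Sum>b\<in>Poly_Mapping.keys q. ?s q b)"
    using sum_of_monomials[of p] sum_of_monomials[of q] by simp
  also have "\<dots> = (\<Sum>a\<in>Poly_Mapping.keys p. \<Sum>b\<in>Poly_Mapping.keys q. ?s p a * ?s q b)"
    by (rule sum_product)
  finally have "specialize f (p * q)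
      = (\<Sum>a\<in>Poly_Mapping.keys p. \<Sum>b\<in>Poly_Mapping.keys q. specialize f (?s p a * ?s q b))"
    by (simp add: specialize_sum)
  also have "\<dots> = (\<Sum>a\<in>Poly_Mapping.keys p. \<Sum>b\<in>Poly_Mapping.keys q.
      (of_int (Poly_Mapping.lookup p a) * monomial_value f a) *
      (of_int (Poly_Mapping.lookup q b) * monomial_value f b))"
    by (simp add: mult_single specialize_single monomial_value_add mult_ac)
  also have "\<dots> = specialize f p * specialize f q"
    by (simp add: sum_product[symmetric] specialize_def monomial_value_def)
  finally show ?thesis .
qed

lemma specialize_one [simp]: "specialize f 1 = 1"
  using specialize_single[of f 0 1] by (simp add: monomial_value_def)

lemma specialize_power: "specialize f (p ^ k) = specialize f p ^ k"
  by (induction k) (simp_all add: specialize_mult)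

lemma specialize_prod: "specialize f (\<Prod>i\<in>I. p i) = (\<Prod>i\<in>I. specialize f (p i))"
  by (induction I rule: infinite_finite_induct) (auto simp: specialize_mult)

lemma specialize_mvar [simp]: "specialize f (mvar v) = f v"
  by (simp add: mvar_def specialize_single monomial_value_def)

section \<open>Variables of a polynomial\<close>

lemma mvars_mvar: "mvars (mvar v :: ('v, 'a::comm_ring_1) mpolynomial) = {v}"
  by (simp add: mvars_def mvar_def)

lemma mvars_one: "mvars (1 :: ('v, 'a::comm_ring_1) mpolynomial) = {}"
  by (simp add: mvars_def)

lemma mvars_add: "mvars (p + q) \<subseteq> mvars p \<union> mvars q"
  unfolding mvars_def using keys_add[of p q] by blast

lemma mvars_diff: "mvars (p - q) \<subseteq> mvars p \<union> mvars q"
proof -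
  have "Poly_Mapping.keys (p - q) \<subseteq> Poly_Mapping.keys p \<union> Poly_Mapping.keys q"
    by (auto simp: in_keys_iff lookup_minus)
  then show ?thesis
    unfolding mvars_def by blast
qed

lemma mvars_mult: "mvars (p * q) \<subseteq> mvars p \<union> mvars q"
proof
  fix v assume "v \<in> mvars (p * q)"
  then obtain mon where mon: "mon \<in> Poly_Mapping.keys (p * q)" "v \<in> Poly_Mapping.keys mon"
    by (auto simp: mvars_def)
  then obtain a b where "mon = a + b" "a \<in> Poly_Mapping.keys p" "b \<in> Poly_Mapping.keys q"
    using keys_mult[of p q] by auto
  then show "v \<in> mvars p \<union> mvars q"
    using mon(2) keys_add[of a b] by (auto simp: mvars_def)
qed

lemma mvars_power: "mvars (p ^ k) \<subseteq> mvars p"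
proof (induction k)
  case (Suc k)
  then show ?case
    using mvars_mult[of p "p ^ k"] by auto
qed (simp add: mvars_one)

lemma mvars_prod: "mvars (\<Prod>i\<in>I. p i) \<subseteq> (\<Union>i\<in>I. mvars (p i))"
proof (induction I rule: infinite_finite_induct)
  case (insert i I)
  then show ?case
    using mvars_mult[of "p i" "prod p I"] by auto
qed (simp_all add: mvars_one)

lemma mvars_sum: "mvars (\<Sum>i\<in>I. p i) \<subseteq> (\<Union>i\<in>I. mvars (p i))"
proof (induction I rule: infinite_finite_induct)
  case (insert i I)
  then show ?case
    using mvars_add[of "p i" "sum p I"] by auto
qed (simp_all add: mvars_def)

section \<open>Embedding into the field of fractions\<close>

lemma to_field_one: "to_field 1 = 1"
  by (simp add: One_fract_def)

lemma to_field_add: "to_field (p + q) = to_field p + to_field q"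
  by simp

lemma to_field_mult: "to_field (p * q) = to_field p * to_field q"
  by simp

lemma to_field_diff: "to_field (p - q) = to_field p - to_field q"
  by simp

lemma to_field_sum: "to_field (\<Sum>i\<in>I. p i) = (\<Sum>i\<in>I. to_field (p i))"
  by (induction I rule: infinite_finite_induct)
     (simp_all add: Zero_fract_def to_field_add del: add_fract)

lemma to_field_prod: "to_field (\<Prod>i\<in>I. p i) = (\<Prod>i\<in>I. to_field (p i))"
  by (induction I rule: infinite_finite_induct)
     (simp_all add: to_field_one to_field_mult del: mult_fract)

lemma to_field_power: "to_field (p ^ k) = to_field p ^ k"
  by (induction k) (simp_all add: to_field_one to_field_mult del: mult_fract)

lemma to_field_inject: "to_field p = to_field q \<longleftrightarrow> p = q"
  by (simp add: eq_fract)

lemma mvar_neq_one: "(mvar v :: ('v, 'a::comm_ring_1) mpolynomial) \<noteq> 1"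
  by (metis empty_not_insert mvars_mvar mvars_one)

lemma to_field_mvar_neq_one: "to_field (mvar v) - 1 \<noteq> 0"
  using to_field_inject[of "mvar v" 1] by (simp add: mvar_neq_one to_field_one)

section \<open>Summation over subsets by their image\<close>

lemma sum_power_card_Pow:
  fixes z :: "'a::comm_semiring_1"
  assumes "finite S"
  shows "(\<Sum>C\<in>Pow S. z ^ card C) = (z + 1) ^ card S"
  using prod_add[OF assms, of "\<lambda>_. z" "\<lambda>_. 1"] by simp

text \<open>
  Summation over the subsets \<open>B\<close> of \<open>E\<close> grouped by their image \<open>A\<close>: a set with image \<open>A\<close> arises by
  choosing a nonempty subset of the fibre over each \<open>e \<in> A\<close>, and over a fibre with \<open>k\<close> elements
  these choices contribute \<open>(1 + z)\<^sup>k - 1\<close>.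
\<close>

lemma sum_Pow_by_image:
  fixes z :: "'b::comm_ring_1" and \<pi> :: "'c \<Rightarrow> 'e"
  assumes "finite E"
  shows "(\<Sum>B\<in>Pow E. g (\<pi> ` B) * z ^ card B)
    = (\<Sum>A\<in>Pow (\<pi> ` E). g A * (\<Prod>e\<in>A. (z + 1) ^ card {x \<in> E. \<pi> x = e} - 1))"
proof -
  let ?E = "\<lambda>e. {x \<in> E. \<pi> x = e}"
  have "(\<Sum>B\<in>Pow E. g (\<pi> ` B) * z ^ card B)
      = (\<Sum>A\<in>Pow (\<pi> ` E). \<Sum>B | B \<in> Pow E \<and> \<pi> ` B = A. g (\<pi> ` B) * z ^ card B)"
    by (rule sum.group[symmetric]) (use assms in auto)
  also have "\<dots> = (\<Sum>A\<in>Pow (\<pi> ` E). g A * (\<Sum>B | B \<in> Pow E \<and> \<pi> ` B = A. z ^ card B))"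
    by (simp add: sum_distrib_left)
  also have "\<dots> = (\<Sum>A\<in>Pow (\<pi> ` E). g A * (\<Prod>e\<in>A. (z + 1) ^ card (?E e) - 1))"
  proof (rule sum.cong[OF refl], rule arg_cong[where f = "\<lambda>s. g _ * s"])
    fix A assume "A \<in> Pow (\<pi> ` E)"
    then have finA: "finite A"
      using assms by (auto intro: finite_subset)
    have finE: "finite (?E e)" for e
      using assms by simp
    have "(\<Prod>e\<in>A. (z + 1) ^ card (?E e) - 1) = (\<Prod>e\<in>A. \<Sum>C\<in>Pow (?E e) - {{}}. z ^ card C)"
      using assms by (simp add: sum_diff1 sum_power_card_Pow)
    also have "\<dots> = (\<Sum>h\<in>PiE A (\<lambda>e. Pow (?E e) - {{}}). \<Prod>e\<in>A. z ^ card (h e))"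
      by (rule prod_sum_PiE) (use finA assms in auto)
    also have "\<dots> = (\<Sum>B | B \<in> Pow E \<and> \<pi> ` B = A. z ^ card B)"
    proof (rule sum.reindex_bij_witness[where
          i = "\<lambda>B. \<lambda>e\<in>A. {x \<in> B. \<pi> x = e}" and j = "\<lambda>h. \<Union>e\<in>A. h e"])
      fix h assume h: "h \<in> PiE A (\<lambda>e. Pow (?E e) - {{}})"
      have sub: "h e \<subseteq> ?E e" "h e \<noteq> {}" if "e \<in> A" for e
        using PiE_mem[OF h that] by auto
      have "{x \<in> (\<Union>e\<in>A. h e). \<pi> x = e} = h e" if "e \<in> A" for e
        using sub that by blast
      then have "(\<lambda>e\<in>A. {x \<in> (\<Union>e\<in>A. h e). \<pi> x = e}) e = h e" for e
        using PiE_arb[OF h] by (cases "e \<in> A") simp_all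
      then show "(\<lambda>e\<in>A. {x \<in> (\<Union>e\<in>A. h e). \<pi> x = e}) = h"
        by (rule ext)
      have "\<pi> ` (\<Union>e\<in>A. h e) = A"
      proof
        show "\<pi> ` (\<Union>e\<in>A. h e) \<subseteq> A"
          using sub by blast
        show "A \<subseteq> \<pi> ` (\<Union>e\<in>A. h e)"
        proof
          fix e assume e: "e \<in> A"
          then obtain x where "x \<in> h e"
            using sub by blast
          then show "e \<in> \<pi> ` (\<Union>e\<in>A. h e)"
            using sub e by blast
        qed
      qed
      then show "(\<Union>e\<in>A. h e) \<in> {B. B \<in> Pow E \<and> \<pi> ` B = A}"
        using sub by blast
      have "card (\<Union>e\<in>A. h e) = (\<Sum>e\<in>A. card (h e))"
      proof (rule card_UN_disjoint[OF finA])
        show "\<forall>e\<in>A. finite (h e)"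
          using sub finE by (meson finite_subset)
        show "\<forall>e\<in>A. \<forall>e'\<in>A. e \<noteq> e' \<longrightarrow> h e \<inter> h e' = {}"
          using sub by blast
      qed
      then show "z ^ card (\<Union>e\<in>A. h e) = (\<Prod>e\<in>A. z ^ card (h e))"
        by (simp add: power_sum)
    next
      fix B assume "B \<in> {B. B \<in> Pow E \<and> \<pi> ` B = A}"
      then have B: "B \<subseteq> E" "\<pi> ` B = A"
        by auto
      show "(\<Union>e\<in>A. (\<lambda>e\<in>A. {x \<in> B. \<pi> x = e}) e) = B"
        using B by auto
      show "(\<lambda>e\<in>A. {x \<in> B. \<pi> x = e}) \<in> PiE A (\<lambda>e. Pow (?E e) - {{}})"
        using B by auto
    qed
    finally show "(\<Sum>B | B \<in> Pow E \<and> \<pi> ` B = A. z ^ card B)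
        = (\<Prod>e\<in>A. (z + 1) ^ card (?E e) - 1)" ..
  qed
  finally show ?thesis .
qed

section \<open>The subset expansion of the universal Tutte polynomial\<close>

text \<open>
  The edges of the complete graph on \<open>{1..n}\<close>, each written with its smaller endpoint first.
\<close>

definition edge_pairs :: "nat \<Rightarrow> (nat \<times> nat) set"
  where "edge_pairs n = {(i, j). 1 \<le> i \<and> i < j \<and> j \<le> n}"

lemma edge_pairs_subset: "edge_pairs n \<subseteq> {1..n} \<times> {1..n}"
  by (auto simp: edge_pairs_def)

lemma finite_edge_pairs: "finite (edge_pairs n)"
  using edge_pairs_subset by (rule finite_subset) simp

text \<open>
  The coefficient in the universal series of the squarefree monomial of a set \<open>S \<subseteq> {1..n}\<close>.
\<close>

definition block_weight :: "nat \<Rightarrow> nat set \<Rightarrow> tutte_field"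
  where "block_weight n S =
    (\<Prod>(i, j)\<in>edge_pairs n. if i \<in> S \<and> j \<in> S then q_rat i j * (y_rat - 1) + 1 else 1)
      * inverse (y_rat - 1) ^ card S"

lemma universal_series_subsets:
  "universal_series n = (\<Sum>S\<in>Pow {1..n}. Poly_Mapping.single (multilinear S) (block_weight n S))"
  unfolding universal_series_def
proof (rule sum.reindex_bij_witness[where
      i = "\<lambda>S. \<lambda>j\<in>{1..n}. if j \<in> S then 1 else 0" and j = "\<lambda>l. {j \<in> {1..n}. l j = 1}"])
  fix l assume l: "l \<in> {1..n} \<rightarrow>\<^sub>E {0, 1::nat}"
  define S where "S = {j \<in> {1..n}. l j = 1}"
  have S_sub: "{1..n} \<inter> S = S"
    by (auto simp: S_def)
  have l_eq: "l j = (if j \<in> S then 1 else 0)" if "j \<in> {1..n}" for j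
    using PiE_mem[OF l that] that by (auto simp: S_def)
  have "(\<lambda>j\<in>{1..n}. if j \<in> S then 1 else 0) j = l j" for j
    using l_eq PiE_arb[OF l] by (cases "j \<in> {1..n}") (simp_all del: atLeastAtMost_iff)
  then show "(\<lambda>j\<in>{1..n}. if j \<in> {j \<in> {1..n}. l j = 1} then 1 else 0) = l"
    unfolding S_def by (rule ext)
  show "{j \<in> {1..n}. l j = 1} \<in> Pow {1..n}"
    by auto
  have "(\<Sum>j = 1..n. l j) = (\<Sum>j = 1..n. if j \<in> S then 1 else 0)"
    by (rule sum.cong) (simp_all add: l_eq)
  also have "\<dots> = card S"
    unfolding sum.inter_restrict[OF finite_atLeastAtMost, symmetric] S_sub by simp
  finally have card: "(\<Sum>j = 1..n. l j) = card S" .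
  have "(\<Prod>j = 1..n. mvar j ^ l j) = (\<Prod>j = 1..n. if j \<in> S then mvar j else 1)"
    by (rule prod.cong) (simp_all add: l_eq)
  also have "\<dots> = (\<Prod>j\<in>S. mvar j)"
    unfolding prod.inter_restrict[OF finite_atLeastAtMost, symmetric] S_sub ..
  also have "\<dots> = Poly_Mapping.single (multilinear S) (1 :: tutte_field)"
    unfolding mvar_def prod_single multilinear_def by simp
  finally have mon: "(\<Prod>j = 1..n. mvar j ^ l j) = Poly_Mapping.single (multilinear S) (1 :: tutte_field)" .
  have "(\<Prod>(i, j)\<in>edge_pairs n. (q_rat i j * (y_rat - 1) + 1) ^ (l i * l j))
      = (\<Prod>(i, j)\<in>edge_pairs n. if i \<in> S \<and> j \<in> S then q_rat i j * (y_rat - 1) + 1 else 1)"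
  proof (rule prod.cong[OF refl], clarify)
    fix i j assume "(i, j) \<in> edge_pairs n"
    then have "i \<in> {1..n}" "j \<in> {1..n}"
      using edge_pairs_subset by blast+
    then show "(q_rat i j * (y_rat - 1) + 1) ^ (l i * l j)
        = (if i \<in> S \<and> j \<in> S then q_rat i j * (y_rat - 1) + 1 else 1)"
      using l_eq by simp
  qed
  then have "(\<Prod>(i, j)\<in>edge_pairs n. (q_rat i j * (y_rat - 1) + 1) ^ (l i * l j))
      * (y_rat - 1) powi (- int (\<Sum>j = 1..n. l j)) = block_weight n S"
    by (simp only: block_weight_def card power_int_minus power_int_of_nat power_inverse)
  then show "Poly_Mapping.single (multilinear {j \<in> {1..n}. l j = 1}) (block_weight n {j \<in> {1..n}. l j = 1})
    = mconst ((\<Prod>(i, j) \<in> {(i, j). 1 \<le> i \<and> i < j \<and> j \<le> n}.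
                  (q_rat i j * (y_rat - 1) + 1) ^ (l i * l j))
               * (y_rat - 1) powi (- int (\<Sum>j = 1..n. l j)))
       * (\<Prod>j = 1..n. mvar j ^ l j)"
    unfolding mon S_def[symmetric] edge_pairs_def[symmetric]
    by (simp only: mconst_def mult_single mult_1_right add_0)
next
  fix S assume S: "S \<in> Pow {1..n}"
  show "{j \<in> {1..n}. (\<lambda>j\<in>{1..n}. if j \<in> S then 1 else 0) j = (1::nat)} = S"
    using S by auto
  show "(\<lambda>j\<in>{1..n}. if j \<in> S then 1 else 0) \<in> {1..n} \<rightarrow>\<^sub>E {0, 1::nat}"
    by auto
qed

lemma lookup_universal_series_zero: "Poly_Mapping.lookup (universal_series n) 0 = 1"
proof -
  have "Poly_Mapping.lookup (universal_series n) 0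
      = (\<Sum>S\<in>Pow {1..n}. if S = {} then block_weight n S else 0)"
    unfolding universal_series_subsets lookup_sum
    by (rule sum.cong) (auto simp: lookup_single when_def multilinear_eq_0_iff finite_subset)
  also have "\<dots> = block_weight n {}"
    by (simp add: sum.delta')
  finally show ?thesis
    by (simp add: block_weight_def case_prod_beta)
qed

text \<open>
  The coefficient of \<open>t\<^sub>1 \<cdots> t\<^sub>n\<close> in the \<open>N\<close>-th power is, up to a power of \<open>y - 1\<close>, a Potts
  partition function with \<open>N\<close> colours.
\<close>

lemma lookup_universal_series_power:
  "Poly_Mapping.lookup (universal_series n ^ N) (multilinear {1..n})
    = inverse (y_rat - 1) ^ n * (\<Sum>A\<in>Pow (edge_pairs n).
        (\<Prod>(i, j)\<in>A. q_rat i j * (y_rat - 1)) * of_nat N ^ components {1..n} A)"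
proof -
  let ?b = "\<lambda>i j. q_rat i j * (y_rat - 1) + 1"
  have "(\<Prod>k<N. block_weight n {i \<in> {1..n}. f i = k})
      = inverse (y_rat - 1) ^ n * (\<Prod>(i, j)\<in>edge_pairs n. if f i = f j then ?b i j else 1)"
    if f: "f \<in> {1..n} \<rightarrow>\<^sub>E {..<N}" for f
  proof -
    have "(\<Sum>k<N. card {i \<in> {1..n}. f i = k}) = (\<Sum>k<N. \<Sum>i | i \<in> {1..n} \<and> f i = k. 1)"
      by simp
    also have "\<dots> = (\<Sum>i\<in>{1..n}. 1)"
      by (rule sum.group) (use f in auto)
    finally have card: "(\<Sum>k<N. card {i \<in> {1..n}. f i = k}) = n"
      by simp
    \<comment> \<open>Both endpoints lie in the fibre over \<open>k\<close> for \<open>k = f i = f j\<close> only.\<close>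
    have pair: "(\<Prod>k<N. if i \<in> {i \<in> {1..n}. f i = k} \<and> j \<in> {i \<in> {1..n}. f i = k} then ?b i j else 1)
        = (if f i = f j then ?b i j else 1)" if "(i, j) \<in> edge_pairs n" for i j
    proof -
      have ij: "i \<in> {1..n}" "j \<in> {1..n}"
        using that edge_pairs_subset by blast+
      have "(\<Prod>k<N. if i \<in> {i \<in> {1..n}. f i = k} \<and> j \<in> {i \<in> {1..n}. f i = k} then ?b i j else 1)
          = (\<Prod>k<N. if k = f i then if f i = f j then ?b i j else 1 else 1)"
        using ij by (intro prod.cong) auto
      also have "\<dots> = (if f i = f j then ?b i j else 1)"
        using PiE_mem[OF f ij(1)] by (subst prod.delta) auto
      finally show ?thesis .
    qed
    have "(\<Prod>k<N. block_weight n {i \<in> {1..n}. f i = k})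
        = (\<Prod>k<N. \<Prod>(i, j)\<in>edge_pairs n.
            if i \<in> {i \<in> {1..n}. f i = k} \<and> j \<in> {i \<in> {1..n}. f i = k} then ?b i j else 1)
          * inverse (y_rat - 1) ^ (\<Sum>k<N. card {i \<in> {1..n}. f i = k})"
      unfolding block_weight_def prod.distrib power_sum ..
    also have "(\<Prod>k<N. \<Prod>(i, j)\<in>edge_pairs n.
            if i \<in> {i \<in> {1..n}. f i = k} \<and> j \<in> {i \<in> {1..n}. f i = k} then ?b i j else 1)
        = (\<Prod>(i, j)\<in>edge_pairs n. \<Prod>k<N.
            if i \<in> {i \<in> {1..n}. f i = k} \<and> j \<in> {i \<in> {1..n}. f i = k} then ?b i j else 1)"
      unfolding case_prod_beta by (rule prod.swap)
    also have "\<dots> = (\<Prod>(i, j)\<in>edge_pairs n. if f i = f j then ?b i j else 1)"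
      using pair by (intro prod.cong refl) (clarify, blast)
    finally show ?thesis
      unfolding card by (rule trans[OF _ mult.commute])
  qed
  then have "Poly_Mapping.lookup (universal_series n ^ N) (multilinear {1..n})
      = (\<Sum>f\<in>{1..n} \<rightarrow>\<^sub>E {..<N}. inverse (y_rat - 1) ^ n *
          (\<Prod>(i, j)\<in>edge_pairs n. if f i = f j then ?b i j else 1))"
    unfolding universal_series_subsets lookup_multilinear_power[OF finite_atLeastAtMost]
    by (intro sum.cong refl)
  also have "\<dots> = inverse (y_rat - 1) ^ n * (\<Sum>f\<in>{1..n} \<rightarrow>\<^sub>E {..<N}.
          \<Prod>(i, j)\<in>edge_pairs n. if f i = f j then ?b i j else 1)"
    by (rule sum_distrib_left[symmetric])
  also have "(\<Sum>f\<in>{1..n} \<rightarrow>\<^sub>E {..<N}. \<Prod>(i, j)\<in>edge_pairs n. if f i = f j then ?b i j else 1)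
      = (\<Sum>A\<in>Pow (edge_pairs n).
        (\<Prod>(i, j)\<in>A. q_rat i j * (y_rat - 1)) * of_nat N ^ components {1..n} A)"
    using potts_partition_function[OF finite_atLeastAtMost edge_pairs_subset,
        of "\<lambda>(i, j). q_rat i j * (y_rat - 1)" n N]
    by (simp only: prod.case)
  finally show ?thesis .
qed

lemma coeff_powr_universal_series:
  "coeff_powr (universal_series n) a (multilinear {1..n})
    = inverse (y_rat - 1) ^ n * (\<Sum>A\<in>Pow (edge_pairs n).
        (\<Prod>(i, j)\<in>A. q_rat i j * (y_rat - 1)) * a ^ components {1..n} A)"
proof -
  let ?p = "smult (inverse (y_rat - 1) ^ n) (\<Sum>A\<in>Pow (edge_pairs n).
    monom (\<Prod>(i, j)\<in>A. q_rat i j * (y_rat - 1)) (components {1..n} A))"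
  have p: "poly ?p b = inverse (y_rat - 1) ^ n * (\<Sum>A\<in>Pow (edge_pairs n).
        (\<Prod>(i, j)\<in>A. q_rat i j * (y_rat - 1)) * b ^ components {1..n} A)" for b
    by (simp only: poly_smult poly_sum poly_monom)
  have "coeff_powr (universal_series n) a (multilinear {1..n}) = poly ?p a"
    by (rule coeff_powr_eqI[OF lookup_universal_series_zero])
       (simp only: p lookup_universal_series_power)
  then show ?thesis
    by (simp only: p)
qed

text \<open>
  The explicit form of the universal Tutte polynomial. The truncated subtractions in the exponents
  are exact for \<open>n \<ge> 1\<close>, by \<open>components_pos\<close> and \<open>card_le_components_plus_card\<close>.
\<close>

definition subset_expansion :: "nat \<Rightarrow> tutte_ring"
  where "subset_expansion n = (\<Sum>A\<in>Pow (edge_pairs n).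
    (\<Prod>(i, j)\<in>A. mvar (QVar i j)) * (mvar XVar - 1) ^ (components {1..n} A - 1)
      * (mvar YVar - 1) ^ (components {1..n} A + card A - n))"

lemma mvars_subset_expansion: "mvars (subset_expansion n) \<subseteq> tutte_vars n"
proof -
  let ?q = "\<lambda>A. \<Prod>(i, j)\<in>A. mvar (QVar i j) :: tutte_ring"
  let ?x = "\<lambda>A. (mvar XVar - 1 :: tutte_ring) ^ (components {1..n} A - 1)"
  let ?y = "\<lambda>A. (mvar YVar - 1 :: tutte_ring) ^ (components {1..n} A + card A - n)"
  have "mvars (?q A * ?x A * ?y A) \<subseteq> tutte_vars n" if "A \<subseteq> edge_pairs n" for A
  proof -
    have "mvars (?q A) \<subseteq> (\<Union>e\<in>A. mvars ((case e of (i, j) \<Rightarrow> mvar (QVar i j)) :: tutte_ring))"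
      by (rule mvars_prod)
    also have "\<dots> \<subseteq> tutte_vars n"
      using that by (auto simp: mvars_mvar tutte_vars_def edge_pairs_def)
    finally have "mvars (?q A) \<subseteq> tutte_vars n" .
    moreover have "mvars (?x A) \<subseteq> tutte_vars n"
      using mvars_power[of "mvar XVar - 1 :: tutte_ring"] mvars_diff[of "mvar XVar :: tutte_ring" 1]
      by (fastforce simp: mvars_mvar mvars_one tutte_vars_def)
    moreover have "mvars (?y A) \<subseteq> tutte_vars n"
      using mvars_power[of "mvar YVar - 1 :: tutte_ring"] mvars_diff[of "mvar YVar :: tutte_ring" 1]
      by (fastforce simp: mvars_mvar mvars_one tutte_vars_def)
    ultimately show ?thesis
      using mvars_mult[of "?q A * ?x A" "?y A"] mvars_mult[of "?q A" "?x A"] by blast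
  qed
  then show ?thesis
    unfolding subset_expansion_def by (intro order_trans[OF mvars_sum] UN_least) blast
qed

lemma edge_count_bound:
  assumes "A \<subseteq> edge_pairs n"
  shows "n \<le> components {1..n} A + card A"
proof -
  have "finite A" "A \<subseteq> {1..n} \<times> {1..n}"
    using assms finite_edge_pairs edge_pairs_subset by (blast intro: finite_subset)+
  then show ?thesis
    using card_le_components_plus_card[of "{1..n}" A] by simp
qed

lemma is_universal_tutte_subset_expansion:
  assumes "n \<ge> 1"
  shows "is_universal_tutte n (subset_expansion n)"
proof -
  let ?x = "x_rat - 1" and ?y = "y_rat - 1"
  have y: "?y \<noteq> 0"
    by (rule to_field_mvar_neq_one)
  have "?x * to_field (subset_expansion n)
      = (\<Sum>A\<in>Pow (edge_pairs n). ?x * ((\<Prod>(i, j)\<in>A. q_rat i j) * ?x ^ (components {1..n} A - 1)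
          * ?y ^ (components {1..n} A + card A - n)))"
    unfolding subset_expansion_def to_field_sum to_field_mult to_field_power to_field_diff
      to_field_one to_field_prod sum_distrib_left case_prod_beta ..
  also have "\<dots> = (\<Sum>A\<in>Pow (edge_pairs n). inverse ?y ^ n *
      ((\<Prod>(i, j)\<in>A. q_rat i j * ?y) * (?x * ?y) ^ components {1..n} A))"
  proof (rule sum.cong[OF refl])
    fix A assume "A \<in> Pow (edge_pairs n)"
    then have A: "A \<subseteq> edge_pairs n" by simp
    let ?\<kappa> = "components {1..n} A"
    have "?\<kappa> \<ge> 1"
      using assms by (intro components_pos) auto
    then have x: "?x ^ ?\<kappa> = ?x ^ (?\<kappa> - 1) * ?x"
      by (intro power_minus_mult[symmetric]) linarith
    have z: "?y ^ (?\<kappa> + card A - n) = inverse ?y ^ n * (?y ^ ?\<kappa> * ?y ^ card A)"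
      using power_diff[OF y edge_count_bound[OF A]]
      by (simp only: power_add divide_inverse power_inverse mult.commute)
    have q: "(\<Prod>(i, j)\<in>A. q_rat i j * ?y) = (\<Prod>(i, j)\<in>A. q_rat i j) * ?y ^ card A"
      by (simp only: case_prod_unfold prod.distrib prod_constant)
    show "?x * ((\<Prod>(i, j)\<in>A. q_rat i j) * ?x ^ (?\<kappa> - 1) * ?y ^ (?\<kappa> + card A - n))
        = inverse ?y ^ n * ((\<Prod>(i, j)\<in>A. q_rat i j * ?y) * (?x * ?y) ^ ?\<kappa>)"
      unfolding z q power_mult_distrib x by (simp only: mult_ac)
  qed
  also have "\<dots> = coeff_powr (universal_series n) (?x * ?y) (multilinear {1..n})"
    unfolding coeff_powr_universal_series sum_distrib_left ..
  finally show ?thesis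
    using mvars_subset_expansion by (simp only: is_universal_tutte_def multilinear_def simp_thms)
qed

lemma universal_tutte_eq_subset_expansion:
  assumes "n \<ge> 1"
  shows "universal_tutte n = subset_expansion n"
  unfolding universal_tutte_def
proof (rule the_equality)
  show "is_universal_tutte n (subset_expansion n)"
    by (rule is_universal_tutte_subset_expansion[OF assms])
next
  fix T assume "is_universal_tutte n T"
  then have "(x_rat - 1) * to_field T = (x_rat - 1) * to_field (subset_expansion n)"
    using is_universal_tutte_subset_expansion[OF assms] by (simp only: is_universal_tutte_def)
  then have "to_field T = to_field (subset_expansion n)"
    using to_field_mvar_neq_one mult_left_cancel by blast
  then show "T = subset_expansion n"
    by (simp only: to_field_inject)
qed

section \<open>The complete multigraph\<close>

text \<open>
  The pairs of vertices that are joined by an edge in \<open>B\<close>, where \<open>(i, j, k)\<close> stands for the \<open>k\<close>-th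
  edge between \<open>i\<close> and \<open>j\<close>.
\<close>

definition support :: "(nat \<times> nat \<times> nat) set \<Rightarrow> (nat \<times> nat) set"
  where "support B = (\<lambda>(i, j, k). (i, j)) ` B"

lemma num_components_complete_multigraph:
  "num_components (complete_multigraph n m) B = components {1..n} (support B)"
proof -
  have "adjacent_via (complete_multigraph n m) B = support B \<union> (support B)\<inverse>"
  proof (rule set_eqI, clarify)
    fix u v
    show "(u, v) \<in> adjacent_via (complete_multigraph n m) B
        \<longleftrightarrow> (u, v) \<in> support B \<union> (support B)\<inverse>"
      by (force simp: adjacent_via_def complete_multigraph_def support_def doubleton_eq_iff)
  qed
  then show ?thesis
    by (simp add: num_components_def components_def connectivity_def complete_multigraph_def)
qed

lemma finite_edges_complete_multigraph: "finite (edges (complete_multigraph n m))"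
proof -
  have "edges (complete_multigraph n m) \<subseteq> (\<Union>i\<in>{1..n}. \<Union>j\<in>{1..n}. \<Union>k\<in>{..<m i j}. {(i, j, k)})"
    by (auto simp: complete_multigraph_def)
  then show ?thesis
    by (rule finite_subset) simp
qed

lemma support_edges:
  assumes "\<And>i j. 1 \<le> i \<Longrightarrow> i < j \<Longrightarrow> j \<le> n \<Longrightarrow> m i j > 0"
  shows "support (edges (complete_multigraph n m)) = edge_pairs n"
proof (rule set_eqI, clarify)
  fix i j
  have "(i, j) \<in> support (edges (complete_multigraph n m))
      \<longleftrightarrow> (\<exists>k. 1 \<le> i \<and> i < j \<and> j \<le> n \<and> k < m i j)"
    by (simp add: support_def complete_multigraph_def image_iff)
  also have "\<dots> \<longleftrightarrow> (i, j) \<in> edge_pairs n"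
    using assms[of i j] by (auto simp: edge_pairs_def)
  finally show "(i, j) \<in> support (edges (complete_multigraph n m)) \<longleftrightarrow> (i, j) \<in> edge_pairs n" .
qed

lemma components_edge_pairs:
  assumes "n \<ge> 1"
  shows "components {1..n} (edge_pairs n) = 1"
proof -
  have "(u, v) \<in> (edge_pairs n \<union> (edge_pairs n)\<inverse>)\<^sup>*" if "u \<in> {1..n}" "v \<in> {1..n}" for u v
    using that by (cases u v rule: linorder_cases) (auto simp: edge_pairs_def)
  then have "connectivity {1..n} (edge_pairs n) = {1..n} \<times> {1..n}"
    by (auto simp: connectivity_def)
  then have "{1..n} // connectivity {1..n} (edge_pairs n) = {{1..n}}"
    using assms by (auto simp: quotient_def)
  then show ?thesis
    by (simp add: components_def)
qed

theorem corollary4p2: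
  fixes n :: nat and m :: "nat \<Rightarrow> nat \<Rightarrow> nat"
  assumes "n \<ge> 1"
    and "\<And>i j. 1 \<le> i \<Longrightarrow> i < j \<Longrightarrow> j \<le> n \<Longrightarrow> m i j > 0"
  shows "specialize (bracket_substitution m) (universal_tutte n)
    = to_field (tutte_polynomial (complete_multigraph n m))"
proof -
  let ?x = "x_rat - 1" and ?y = "y_rat - 1"
  let ?\<kappa> = "components {1..n}"
  define E where "E = edges (complete_multigraph n m)"
  have finE: "finite E"
    by (simp add: E_def finite_edges_complete_multigraph)
  have supp_E: "support E = edge_pairs n"
    unfolding E_def by (rule support_edges) (rule assms(2))
  have y: "?y \<noteq> 0"
    by (rule to_field_mvar_neq_one)
  \<comment> \<open>The part of the term of \<open>B\<close> that depends only on its support; the rest is \<open>(y - 1)\<^bsup>|B|\<^esup>\<close>.\<close>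
  define g where "g = (\<lambda>A. ?x ^ (?\<kappa> A - 1) * inverse ?y ^ n * ?y ^ ?\<kappa> A)"
  have "specialize (bracket_substitution m) (universal_tutte n)
      = (\<Sum>A\<in>Pow (edge_pairs n). (\<Prod>(i, j)\<in>A. y_bracket (m i j)) * ?x ^ (?\<kappa> A - 1)
          * ?y ^ (?\<kappa> A + card A - n))"
    unfolding universal_tutte_eq_subset_expansion[OF assms(1)] subset_expansion_def
      specialize_sum specialize_mult specialize_power specialize_diff specialize_prod
      case_prod_beta specialize_mvar specialize_one bracket_substitution.simps ..
  also have "\<dots> = (\<Sum>A\<in>Pow (edge_pairs n). g A * (\<Prod>(i, j)\<in>A. (?y + 1) ^ m i j - 1))"
  proof (rule sum.cong[OF refl])
    fix A assume "A \<in> Pow (edge_pairs n)"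
    then have A: "A \<subseteq> edge_pairs n" by simp
    have z: "?y ^ (?\<kappa> A + card A - n) = inverse ?y ^ n * (?y ^ ?\<kappa> A * ?y ^ card A)"
      using power_diff[OF y edge_count_bound[OF A]]
      by (simp only: power_add divide_inverse power_inverse mult.commute)
    have "(?y + 1) ^ k - 1 = y_bracket k * ?y" for k
      by (simp only: y_bracket_def diff_add_cancel times_divide_eq_left nonzero_mult_div_cancel_right[OF y])
    then have q: "(\<Prod>(i, j)\<in>A. (?y + 1) ^ m i j - 1) = (\<Prod>(i, j)\<in>A. y_bracket (m i j)) * ?y ^ card A"
      by (simp only: case_prod_unfold prod.distrib prod_constant)
    show "(\<Prod>(i, j)\<in>A. y_bracket (m i j)) * ?x ^ (?\<kappa> A - 1) * ?y ^ (?\<kappa> A + card A - n)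
        = g A * (\<Prod>(i, j)\<in>A. (?y + 1) ^ m i j - 1)"
      unfolding z q g_def by (simp only: mult_ac)
  qed
  also have "\<dots> = (\<Sum>B\<in>Pow E. g (support B) * ?y ^ card B)"
  proof -
    have multiplicity: "card {e \<in> E. (case e of (i, j, k) \<Rightarrow> (i, j)) = (i, j)} = m i j" if "(i, j) \<in> edge_pairs n" for i j
    proof -
      have "{e \<in> E. (case e of (i, j, k) \<Rightarrow> (i, j)) = (i, j)} = (\<lambda>k. (i, j, k)) ` {..<m i j}"
        using that by (auto simp: E_def complete_multigraph_def edge_pairs_def)
      then show ?thesis
        by (simp add: card_image inj_on_def)
    qed
    have "(\<Prod>e\<in>A. (?y + 1) ^ card {e' \<in> E. (case e' of (i, j, k) \<Rightarrow> (i, j)) = e} - 1)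
        = (\<Prod>(i, j)\<in>A. (?y + 1) ^ m i j - 1)" if "A \<in> Pow (edge_pairs n)" for A
    proof (rule prod.cong[OF refl])
      fix e assume "e \<in> A"
      moreover obtain i j where "e = (i, j)"
        by fastforce
      ultimately show "(?y + 1) ^ card {e' \<in> E. (case e' of (i, j, k) \<Rightarrow> (i, j)) = e} - 1
          = (case e of (i, j) \<Rightarrow> (?y + 1) ^ m i j - 1)"
        using that multiplicity[of i j] by auto
    qed
    then show ?thesis
      unfolding sum_Pow_by_image[OF finE, of g "\<lambda>(i, j, k). (i, j)" ?y, folded support_def, unfolded supp_E]
      by (intro sum.cong refl arg_cong[where f = "\<lambda>t. g _ * t"]) (rule sym)
  qed
  also have "\<dots> = (\<Sum>B\<in>Pow E. ?x ^ (?\<kappa> (support B) - ?\<kappa> (support E))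
      * ?y ^ (?\<kappa> (support B) + card B - n))"
  proof (rule sum.cong[OF refl])
    fix B assume "B \<in> Pow E"
    then have B: "support B \<subseteq> edge_pairs n" "finite B"
      using finE unfolding supp_E[symmetric] support_def
      by (simp_all add: image_mono rev_finite_subset)
    have "card (support B) \<le> card B"
      unfolding support_def by (rule card_image_le[OF B(2)])
    then have "n \<le> ?\<kappa> (support B) + card B"
      using edge_count_bound[OF B(1)] by linarith
    from power_diff[OF y this]
    have z: "?y ^ (?\<kappa> (support B) + card B - n)
        = inverse ?y ^ n * (?y ^ ?\<kappa> (support B) * ?y ^ card B)"
      by (simp only: power_add divide_inverse power_inverse mult.commute)
    show "g (support B) * ?y ^ card B = ?x ^ (?\<kappa> (support B) - ?\<kappa> (support E))
        * ?y ^ (?\<kappa> (support B) + card B - n)"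
      unfolding z g_def supp_E components_edge_pairs[OF assms(1)] by (simp only: mult_ac)
  qed
  also have "\<dots> = to_field (tutte_polynomial (complete_multigraph n m))"
  proof -
    have "card (verts (complete_multigraph n m)) = n"
      by (simp add: complete_multigraph_def)
    then show ?thesis
      unfolding tutte_polynomial_def num_components_complete_multigraph E_def
        to_field_sum to_field_mult to_field_power to_field_diff to_field_one by simp
  qed
  finally show ?thesis .
qed

end
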